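(* Let $\mu(0)$, $\alpha(0)$, $\beta(0)\neq 0$, $\gamma(0)$, $\delta(0)$, $\varepsilon(0)$, $\kappa(0)$ be arbitrary (real) initial data, put $$D(t)=\beta^4(0)\sin^2 2t+\left(2\alpha(0)\sin 2t+\cos 2t\right)^2 ,$$ and let $$\mu(t)=\mu(0)\sqrt{D(t)},\qquad \beta(t)=\frac{\beta(0)}{\sqrt{D(t)}},$$ $$\alpha(t)=\frac{\alpha(0)\cos 4t+\frac14\sin 4t\left(\beta^4(0)+4\alpha^2(0)-1\right)}{D(t)},$$ $$\gamma(t)=\gamma(0)-\frac12\arctan\frac{\beta^2(0)\sin 2t}{2\alpha(0)\sin 2t+\cos 2t},$$ $$\delta(t)=\frac{\delta(0)\left(2\alpha(0)\sin 2t+\cos 2t\right)+\varepsilon(0)\beta^3(0)\sin 2t}{D(t)},$$ $$\varepsilon(t)=\frac{\varepsilon(0)\left(2\alpha(0)\sin 2t+\cos 2t\right)-\beta(0)\delta(0)\sin 2t}{\sqrt{D(t)}},$$ $$\kappa(t)=\kappa(0)+\sin^2 2t\,\frac{\varepsilon(0)\beta^2(0)\left(\alpha(0)\varepsilon(0)-\beta(0)\delta(0)\right)-\alpha(0)\delta^2(0)}{D(t)}+\frac14\sin 4t\,\frac{\varepsilon^2(0)\beta^2(0)-\delta^2(0)}{D(t)} .$$ Then the functions $$\psi_n(x,t)=\frac{e^{i(\alpha x^2+\delta x+\kappa)+i(2n+1)\gamma}}{\sqrt{2^n n!\,\mu\sqrt{\pi}}}\;e^{-(\beta x+\varepsilon)^2/2}\,H_n(\beta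 x+\varepsilon),\qquad n=0,1,2,\dots,$$ form a six-parameter family of square integrable solutions ("dynamic quantum oscillator states") of the harmonic oscillator Schrödinger equation $i\psi_t=-\psi_{xx}+x^2\psi$. It seems that this family cannot be obtained by the standard separation of variables. The case $\beta(0)=1$, $\alpha(0)=\gamma(0)=\delta(0)=\varepsilon(0)=\kappa(0)=0$ corresponds to the textbook oscillator solution.
   Context: $H_n$ are the Hermite polynomials, $H_n(y)=(-1)^n e^{y^2}\frac{d^n}{dy^n}e^{-y^2}$. Square integrability is with respect to $x\in\mathbb{R}$. The expression for $\psi_n$ presupposes $\mu\neq 0$. The functions $\mu,\alpha,\beta,\gamma,\delta,\varepsilon,\kappa$ are the solution, with the given initial data, of the Ermakov-type system $\alpha'+1+4\alpha^2=\beta^4$, $\beta'+4\alpha\beta=0$, $\gamma'+\beta^2=0$, $\delta'+4\alpha\delta=2\beta^3\varepsilon$, $\varepsilon'=-2\beta\delta$, $\kappa'=-\delta^2+\beta^2\varepsilon^2$, $\alpha=\mu'/(4\mu)$ (primes denote $d/dt$). *)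

theory Defs
  imports "HOL-Analysis.Analysis"
begin

definition hermite :: "nat \<Rightarrow> real \<Rightarrow> real" where
  "hermite n y = (-1) ^ n * exp (y\<^sup>2) * (deriv ^^ n) (\<lambda>z. exp (- (z\<^sup>2))) y"

text \<open>
  Throughout, \<open>m0, a0, b0, g0, d0, e0, k0\<close> stand for the initial data
  \<open>\<mu>(0), \<alpha>(0), \<beta>(0), \<gamma>(0), \<delta>(0), \<epsilon>(0), \<kappa>(0)\<close>.
\<close>

definition osc_P :: "real \<Rightarrow> real \<Rightarrow> real" where
  "osc_P a0 t = 2 * a0 * sin (2 * t) + cos (2 * t)"

definition osc_D :: "real \<Rightarrow> real \<Rightarrow> real \<Rightarrow> real" where
  "osc_D a0 b0 t = b0 ^ 4 * (sin (2 * t))\<^sup>2 + (osc_P a0 t)\<^sup>2"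

definition osc_mu :: "real \<Rightarrow> real \<Rightarrow> real \<Rightarrow> real \<Rightarrow> real" where
  "osc_mu m0 a0 b0 t = m0 * sqrt (osc_D a0 b0 t)"

definition osc_alpha :: "real \<Rightarrow> real \<Rightarrow> real \<Rightarrow> real" where
  "osc_alpha a0 b0 t =
     (a0 * cos (4 * t) + 1/4 * sin (4 * t) * (b0 ^ 4 + 4 * a0\<^sup>2 - 1)) / osc_D a0 b0 t"

definition osc_beta :: "real \<Rightarrow> real \<Rightarrow> real \<Rightarrow> real" where
  "osc_beta a0 b0 t = b0 / sqrt (osc_D a0 b0 t)"

text \<open>
  With the principal value of arctan, the formula for \<open>\<gamma>\<close> is undefined at the zeros of
  \<open>osc_P a0\<close> and jumps by \<open>\<pi>/2\<close> there.  Since \<open>\<gamma>\<close> solves \<open>\<gamma>' + \<beta>\<^sup>2 = 0\<close>, the arctan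
  has to be read as its continuous branch vanishing at \<open>t = 0\<close>.
\<close>

definition is_gamma_branch :: "real \<Rightarrow> real \<Rightarrow> real \<Rightarrow> (real \<Rightarrow> real) \<Rightarrow> bool" where
  "is_gamma_branch a0 b0 g0 g \<longleftrightarrow>
     continuous_on UNIV g \<and> g 0 = g0 \<and>
     (\<forall>t. osc_P a0 t \<noteq> 0 \<longrightarrow>
        (\<exists>k::int. g t = g0 - 1/2 * (arctan (b0\<^sup>2 * sin (2 * t) / osc_P a0 t) + of_int k * pi)))"

definition osc_gamma :: "real \<Rightarrow> real \<Rightarrow> real \<Rightarrow> real \<Rightarrow> real" where
  "osc_gamma a0 b0 g0 = (THE g. is_gamma_branch a0 b0 g0 g)"

definition osc_delta :: "real \<Rightarrow> real \<Rightarrow> real \<Rightarrow> real \<Rightarrow> real \<Rightarrow> real" where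
  "osc_delta a0 b0 d0 e0 t =
     (d0 * osc_P a0 t + e0 * b0 ^ 3 * sin (2 * t)) / osc_D a0 b0 t"

definition osc_eps :: "real \<Rightarrow> real \<Rightarrow> real \<Rightarrow> real \<Rightarrow> real \<Rightarrow> real" where
  "osc_eps a0 b0 d0 e0 t =
     (e0 * osc_P a0 t - b0 * d0 * sin (2 * t)) / sqrt (osc_D a0 b0 t)"

definition osc_kappa :: "real \<Rightarrow> real \<Rightarrow> real \<Rightarrow> real \<Rightarrow> real \<Rightarrow> real \<Rightarrow> real" where
  "osc_kappa a0 b0 d0 e0 k0 t =
     k0 + (sin (2 * t))\<^sup>2 * ((e0 * b0\<^sup>2 * (a0 * e0 - b0 * d0) - a0 * d0\<^sup>2) / osc_D a0 b0 t)
        + 1/4 * sin (4 * t) * ((e0\<^sup>2 * b0\<^sup>2 - d0\<^sup>2) / osc_D a0 b0 t)"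

definition ermakov_system ::
  "(real \<Rightarrow> real) \<Rightarrow> (real \<Rightarrow> real) \<Rightarrow> (real \<Rightarrow> real) \<Rightarrow> (real \<Rightarrow> real) \<Rightarrow>
   (real \<Rightarrow> real) \<Rightarrow> (real \<Rightarrow> real) \<Rightarrow> (real \<Rightarrow> real) \<Rightarrow> bool" where
  "ermakov_system \<mu> \<alpha> \<beta> \<gamma> \<delta> \<epsilon> \<kappa> \<longleftrightarrow>
     (\<exists>\<mu>' \<alpha>' \<beta>' \<gamma>' \<delta>' \<epsilon>' \<kappa>' :: real \<Rightarrow> real. \<forall>t.
        (\<mu> has_real_derivative \<mu>' t) (at t) \<and>
        (\<alpha> has_real_derivative \<alpha>' t) (at t) \<and>
        (\<beta> has_real_derivative \<beta>' t) (at t) \<and>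
        (\<gamma> has_real_derivative \<gamma>' t) (at t) \<and>
        (\<delta> has_real_derivative \<delta>' t) (at t) \<and>
        (\<epsilon> has_real_derivative \<epsilon>' t) (at t) \<and>
        (\<kappa> has_real_derivative \<kappa>' t) (at t) \<and>
        \<alpha>' t + 1 + 4 * (\<alpha> t)\<^sup>2 = (\<beta> t) ^ 4 \<and>
        \<beta>' t + 4 * \<alpha> t * \<beta> t = 0 \<and>
        \<gamma>' t + (\<beta> t)\<^sup>2 = 0 \<and>
        \<delta>' t + 4 * \<alpha> t * \<delta> t = 2 * (\<beta> t) ^ 3 * \<epsilon> t \<and>
        \<epsilon>' t = - 2 * \<beta> t * \<delta> t \<and>
        \<kappa>' t = - (\<delta> t)\<^sup>2 + (\<beta> t)\<^sup>2 * (\<epsilon> t)\<^sup>2 \<and>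
        \<mu> t \<noteq> 0 \<and> \<alpha> t = \<mu>' t / (4 * \<mu> t))"

text \<open>
  \<open>\<mu>\<close> has the constant sign of \<open>m0\<close>, which may be negative, so the normalising square root is
  the principal complex one; it is the real square root when \<open>m0 > 0\<close>.
\<close>

definition osc_psi ::
  "real \<Rightarrow> real \<Rightarrow> real \<Rightarrow> real \<Rightarrow> real \<Rightarrow> real \<Rightarrow> real \<Rightarrow> nat \<Rightarrow> real \<Rightarrow> real \<Rightarrow> complex" where
  "osc_psi m0 a0 b0 g0 d0 e0 k0 n x t =
    (let \<mu> = osc_mu m0 a0 b0 t; \<alpha> = osc_alpha a0 b0 t; \<beta> = osc_beta a0 b0 t;
         \<gamma> = osc_gamma a0 b0 g0 t; \<delta> = osc_delta a0 b0 d0 e0 t;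
         \<epsilon> = osc_eps a0 b0 d0 e0 t; \<kappa> = osc_kappa a0 b0 d0 e0 k0 t
     in exp (\<i> * of_real (\<alpha> * x\<^sup>2 + \<delta> * x + \<kappa>) + \<i> * of_real ((2 * real n + 1) * \<gamma>))
          / csqrt (of_real (2 ^ n * fact n * \<mu> * sqrt pi))
        * of_real (exp (- (\<beta> * x + \<epsilon>)\<^sup>2 / 2))
        * of_real (hermite n (\<beta> * x + \<epsilon>)))"

definition square_integrable :: "(real \<Rightarrow> complex) \<Rightarrow> bool" where
  "square_integrable f \<longleftrightarrow>
     f \<in> borel_measurable lborel \<and> integrable lborel (\<lambda>x. (norm (f x))\<^sup>2)"

text \<open>Classical solutions of \<open>i \<psi>\<^sub>t = - \<psi>\<^sub>x\<^sub>x + x\<^sup>2 \<psi>\<close> on all of space-time; arguments are \<open>x\<close>, then \<open>t\<close>.\<close>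

definition solves_oscillator_schroedinger :: "(real \<Rightarrow> real \<Rightarrow> complex) \<Rightarrow> bool" where
  "solves_oscillator_schroedinger \<psi> \<longleftrightarrow>
     (\<exists>\<psi>t \<psi>x \<psi>xx :: real \<Rightarrow> real \<Rightarrow> complex. \<forall>x t.
        ((\<lambda>s. \<psi> x s) has_vector_derivative \<psi>t x t) (at t) \<and>
        ((\<lambda>y. \<psi> y t) has_vector_derivative \<psi>x x t) (at x) \<and>
        ((\<lambda>y. \<psi>x y t) has_vector_derivative \<psi>xx x t) (at x) \<and>
        \<i> * \<psi>t x t = - \<psi>xx x t + of_real (x\<^sup>2) * \<psi> x t)"

text \<open>The stationary state of energy \<open>2 n + 1\<close>, normalised in \<open>L\<^sup>2\<close>.\<close>

definition textbook_state :: "nat \<Rightarrow> real \<Rightarrow> real \<Rightarrow> complex" where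
  "textbook_state n x t =
     exp (- \<i> * of_real ((2 * real n + 1) * t))
       * of_real (exp (- x\<^sup>2 / 2) * hermite n x / sqrt (2 ^ n * fact n * sqrt pi))"

end

(* Write psi_n = c e^{iS} R with S = alpha x^2 + delta x + kappa + (2n+1) gamma and
   R = D^{-1/4} phi_n(beta x + epsilon), where phi_n(y) = e^{-y^2/2} H_n(y) satisfies
   phi_n'' = (y^2 - (2n+1)) phi_n.  Comparing powers of x in the continuity and Hamilton-Jacobi
   equations for R and S gives exactly the Ermakov-type system.  With s = sin 2t, c = cos 2t, all
   closed formulas are quotients with denominator D or sqrt D, and D' = 8 alpha D; each equation
   of the system then becomes a polynomial identity in s and c, homogeneous up to factors
   s^2 + c^2 = 1. *)
theory Submission
  imports Defs "HOL-Probability.Distributions"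
begin

section \<open>Hermite polynomials and Gaussian moments\<close>

fun hermite_poly :: "nat \<Rightarrow> real poly" where
  "hermite_poly 0 = 1"
| "hermite_poly (Suc n) = [:0, 2:] * hermite_poly n - pderiv (hermite_poly n)"

text \<open>Differentiating p e^{-z^2} gives (p' - 2 z p) e^{-z^2}, which up to sign is the
  recursion of \<open>hermite_poly\<close>.\<close>

lemma deriv_gaussian:
  "(deriv ^^ n) (\<lambda>z. exp (- (z\<^sup>2))) = (\<lambda>z::real. (-1) ^ n * poly (hermite_poly n) z * exp (- (z\<^sup>2)))"
proof (induction n)
  case (Suc n)
  show ?case
    unfolding funpow.simps o_def Suc
    by (intro ext DERIV_imp_deriv)
       (auto intro!: derivative_eq_intros simp: algebra_simps)
qed auto

lemma hermite_eq_poly: "hermite n y = poly (hermite_poly n) y"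
  unfolding hermite_def deriv_gaussian
  by (simp add: exp_minus field_simps flip: power_mult_distrib)

text \<open>Differentiating the recursion and inserting Hermite's equation for n gives the lowering
  rule H_{n+1}' = 2 (n+1) H_n (\<open>p1\<close>). With its derivative \<open>p2\<close>, the
  equation for n+1 reduces to the recursion itself.\<close>

lemma hermite_poly_ode:
  "pderiv (pderiv (hermite_poly n)) - [:0, 2:] * pderiv (hermite_poly n)
     + of_nat (2 * n) * hermite_poly n = 0"
proof (induction n)
  case 0
  show ?case by (simp add: pderiv_1)
next
  case (Suc n)
  let ?p = "hermite_poly n"
  have X: "pderiv [:0, 2::real:] = 2" by (simp add: pderiv_pCons numeral_poly)
  have p'': "pderiv (pderiv ?p) = [:0, 2:] * pderiv ?p - of_nat (2 * n) * ?p"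
    using Suc by (simp add: algebra_simps)
  have p1: "pderiv (hermite_poly (Suc n)) = of_nat (2 * Suc n) * ?p"
    unfolding hermite_poly.simps pderiv_diff pderiv_mult X p'' by (simp add: algebra_simps)
  have p2: "pderiv (pderiv (hermite_poly (Suc n))) = of_nat (2 * Suc n) * pderiv ?p"
    unfolding p1 pderiv_mult pderiv_of_nat by simp
  show ?case
    unfolding p2 unfolding p1 unfolding hermite_poly.simps by (simp only: ring_distribs mult_ac)
qed

lemma integrable_monom_gaussian:
  "integrable lborel (\<lambda>y::real. exp (- y\<^sup>2) * y ^ k)"
proof -
  \<comment> \<open>With variance 1/2 the normal density is e^{-y^2} / sqrt pi, so the integrand is
    a multiple of a normal moment.\<close>
  have "integrable lborel (\<lambda>y. sqrt pi * (normal_density 0 (1 / sqrt 2) y * (y - 0) ^ k))"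
    by (intro integrable_mult_right integrable_normal_moment) auto
  also have "(\<lambda>y. sqrt pi * (normal_density 0 (1 / sqrt 2) y * (y - 0) ^ k)) = (\<lambda>y. exp (- y\<^sup>2) * y ^ k)"
    by (auto simp: normal_density_def power_divide fun_eq_iff)
  finally show ?thesis .
qed

lemma integrable_poly_gaussian:
  fixes p :: "real poly"
  shows "integrable lborel (\<lambda>y. exp (- y\<^sup>2) * poly p y)"
proof -
  have "(\<lambda>y. exp (- y\<^sup>2) * poly p y) = (\<lambda>y. \<Sum>i\<le>degree p. coeff p i * (exp (- y\<^sup>2) * y ^ i))"
    by (auto simp: poly_altdef sum_distrib_left mult_ac)
  then show ?thesis
    using integrable_monom_gaussian by auto
qed

text \<open>The principal root is not multiplicative in general, but a nonnegative factor does not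
  reverse the sign of x. This separates the time-dependent part of mu from m0, which may be
  negative.\<close>

lemma csqrt_of_real_mult_nonneg:
  fixes r x :: real
  assumes "r \<ge> 0"
  shows "csqrt (of_real (r * x)) = of_real (sqrt r) * csqrt (of_real x)"
proof (cases "x \<ge> 0")
  case True
  then show ?thesis using assms by (simp add: csqrt_of_real_nonneg real_sqrt_mult flip: of_real_mult)
next
  case False
  then have "r * x \<le> 0" using assms by (simp add: mult_nonneg_nonpos)
  then show ?thesis using False assms
    by (simp add: csqrt_of_real_nonpos flip: of_real_mult real_sqrt_mult)
qed

section \<open>The denominator D and the Ermakov-type system\<close>

lemma osc_D_pos:
  assumes "b0 \<noteq> 0"
  shows "osc_D a0 b0 t > 0"
proof (cases "sin (2 * t) = 0")
  case True
  \<comment> \<open>Here P reduces to cos 2t, which is 1 or -1, so D = 1.\<close>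
  with sin_zero_abs_cos_one[OF True] show ?thesis
    by (auto simp: osc_D_def osc_P_def)
next
  case False
  then show ?thesis using assms
    by (auto simp: osc_D_def intro!: add_pos_nonneg mult_pos_pos zero_less_power_eq[THEN iffD2])
qed

lemma sin_4: "sin (4 * t) = 2 * sin (2 * t) * cos (2 * t :: real)"
  using sin_double[of "2 * t"] by simp

lemma cos_4: "cos (4 * t) = (cos (2 * t :: real))\<^sup>2 - (sin (2 * t))\<^sup>2"
  using cos_double[of "2 * t"] by simp

lemma osc_P_deriv:
  "(osc_P a0 has_real_derivative 4 * a0 * cos (2 * t) - 2 * sin (2 * t)) (at t)"
  unfolding osc_P_def by (auto intro!: derivative_eq_intros)

text \<open>Since mu is a multiple of sqrt D, this is the equation alpha = mu'/(4 mu) in terms of D.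
  The derivatives of mu and beta follow from it.\<close>

lemma osc_D_deriv:
  assumes "b0 \<noteq> 0"
  shows "(osc_D a0 b0 has_real_derivative 8 * osc_alpha a0 b0 t * osc_D a0 b0 t) (at t)"
proof -
  have "8 * osc_alpha a0 b0 t * osc_D a0 b0 t
      = b0 ^ 4 * (2 * sin (2 * t) * (cos (2 * t) * 2))
        + 2 * osc_P a0 t * (4 * a0 * cos (2 * t) - 2 * sin (2 * t))"
    using osc_D_pos[OF assms, of a0 t]
    by (simp add: osc_alpha_def sin_4 cos_4 osc_P_def) algebra
  then show ?thesis
    unfolding osc_D_def[abs_def]
    by (auto intro!: derivative_eq_intros osc_P_deriv simp: osc_D_def)
qed

lemma sqrt_osc_D_deriv:
  assumes "b0 \<noteq> 0"
  shows "((\<lambda>t. sqrt (osc_D a0 b0 t)) has_real_derivative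
           4 * osc_alpha a0 b0 t * sqrt (osc_D a0 b0 t)) (at t)"
  using osc_D_pos[OF assms, of a0 t]
  by (auto intro!: derivative_eq_intros osc_D_deriv assms simp: field_simps)

lemma osc_mu_deriv:
  assumes "b0 \<noteq> 0"
  shows "(osc_mu m0 a0 b0 has_real_derivative 4 * osc_alpha a0 b0 t * osc_mu m0 a0 b0 t) (at t)"
  unfolding osc_mu_def[abs_def]
  by (rule derivative_eq_intros sqrt_osc_D_deriv assms refl)+ simp

lemma osc_beta_deriv:
  assumes "b0 \<noteq> 0"
  shows "(osc_beta a0 b0 has_real_derivative - 4 * osc_alpha a0 b0 t * osc_beta a0 b0 t) (at t)"
  unfolding osc_beta_def[abs_def] using osc_D_pos[OF assms, of a0 t]
  by - ((rule derivative_eq_intros sqrt_osc_D_deriv assms refl)+, auto simp: field_simps)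

lemma osc_beta_power:
  assumes "b0 \<noteq> 0"
  shows "(osc_beta a0 b0 t)\<^sup>2 = b0\<^sup>2 / osc_D a0 b0 t"
    and "(osc_beta a0 b0 t)^4 = b0^4 / (osc_D a0 b0 t)\<^sup>2"
proof -
  show *: "(osc_beta a0 b0 t)\<^sup>2 = b0\<^sup>2 / osc_D a0 b0 t"
    using osc_D_pos[OF assms, of a0 t] by (simp add: osc_beta_def power_divide)
  have "(osc_beta a0 b0 t)^4 = ((osc_beta a0 b0 t)\<^sup>2)\<^sup>2" by simp
  then show "(osc_beta a0 b0 t)^4 = b0^4 / (osc_D a0 b0 t)\<^sup>2"
    unfolding * by (simp add: power_divide)
qed

text \<open>Only the product alpha D is polynomial in sin 2t and cos 2t; in this form alpha enters
  the polynomial identities below.\<close>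

lemma osc_alpha_times_D:
  assumes "b0 \<noteq> 0"
  shows "osc_alpha a0 b0 t * osc_D a0 b0 t
    = a0 * ((cos (2 * t))\<^sup>2 - (sin (2 * t))\<^sup>2)
      + 1/2 * sin (2 * t) * cos (2 * t) * (b0 ^ 4 + 4 * a0\<^sup>2 - 1)"
  using osc_D_pos[OF assms, of a0 t] by (simp add: osc_alpha_def sin_4 cos_4)

lemma osc_alpha_deriv:
  assumes "b0 \<noteq> 0"
  shows "(osc_alpha a0 b0 has_real_derivative
           (osc_beta a0 b0 t)^4 - 1 - 4 * (osc_alpha a0 b0 t)\<^sup>2) (at t)"
proof -
  define s c where "s = sin (2 * t)" and "c = cos (2 * t)"
  define \<alpha> D where "\<alpha> = osc_alpha a0 b0 t" and "D = osc_D a0 b0 t"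
  \<comment> \<open>\<open>N'\<close> is the derivative of the numerator of alpha, rewritten in s
    and c.\<close>
  define N' where "N' = - 8 * a0 * s * c + (c\<^sup>2 - s\<^sup>2) * (b0 ^ 4 + 4 * a0\<^sup>2 - 1)"
  have D: "D > 0" unfolding D_def by (rule osc_D_pos[OF assms])
  have D': "D = b0 ^ 4 * s\<^sup>2 + (2 * a0 * s + c)\<^sup>2"
    by (simp add: D_def osc_D_def osc_P_def s_def c_def)
  have \<alpha>D: "2 * (\<alpha> * D) = 2 * a0 * (c\<^sup>2 - s\<^sup>2) + s * c * (b0 ^ 4 + 4 * a0\<^sup>2 - 1)"
    using osc_alpha_times_D[OF assms, of a0 t] by (simp add: \<alpha>_def D_def s_def c_def)
  \<comment> \<open>Both sides are homogeneous of degree 4 in s and c, so this holds without s^2 +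
    c^2 = 1, which is used only afterwards.\<close>
  have "N' * D - (2 * (\<alpha> * D))\<^sup>2 + D\<^sup>2 = b0 ^ 4 * (s\<^sup>2 + c\<^sup>2)\<^sup>2"
    unfolding \<alpha>D unfolding D' N'_def by algebra
  then have *: "N' * D - (2 * (\<alpha> * D))\<^sup>2 + D\<^sup>2 = b0 ^ 4" by (simp add: s_def c_def)
  have "(osc_alpha a0 b0 has_real_derivative (N' * D - \<alpha> * D * (8 * \<alpha> * D)) / (D * D)) (at t)"
    unfolding osc_alpha_def[abs_def]
    by (rule derivative_eq_intros osc_D_deriv assms refl)+
       (use D in \<open>simp_all add: sin_4 cos_4 N'_def D_def \<alpha>_def s_def c_def osc_alpha_def\<close>)
  also have "(N' * D - \<alpha> * D * (8 * \<alpha> * D)) / (D * D) = b0 ^ 4 / D\<^sup>2 - 1 - 4 * \<alpha>\<^sup>2"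
    unfolding *[symmetric] using D by (simp add: divide_simps) algebra
  finally show ?thesis by (simp add: osc_beta_power[OF assms] \<alpha>_def D_def)
qed

text \<open>With N and M the numerators of delta and epsilon, the claim comes down to N' - 4 alpha N
  = 2 b0^3 M / D. Its counterpart M' - 4 alpha M = -2 b0 N / D gives the epsilon equation.\<close>

lemma osc_delta_deriv:
  assumes "b0 \<noteq> 0"
  shows "(osc_delta a0 b0 d0 e0 has_real_derivative
           2 * (osc_beta a0 b0 t) ^ 3 * osc_eps a0 b0 d0 e0 t
             - 4 * osc_alpha a0 b0 t * osc_delta a0 b0 d0 e0 t) (at t)"
proof -
  define s c where "s = sin (2 * t)" and "c = cos (2 * t)"
  define \<alpha> D P where "\<alpha> = osc_alpha a0 b0 t" and "D = osc_D a0 b0 t" and "P = osc_P a0 t"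
  define N N' M where "N = d0 * P + e0 * b0 ^ 3 * s"
    and "N' = d0 * (4 * a0 * c - 2 * s) + e0 * b0 ^ 3 * (2 * c)"
    and "M = e0 * P - b0 * d0 * s"
  have D: "D > 0" unfolding D_def by (rule osc_D_pos[OF assms])
  have P: "P = 2 * a0 * s + c" by (simp add: P_def osc_P_def s_def c_def)
  have D': "D = b0 ^ 4 * s\<^sup>2 + P\<^sup>2"
    by (simp add: D_def P_def osc_D_def s_def)
  have \<alpha>D: "2 * (\<alpha> * D) = 2 * a0 * (c\<^sup>2 - s\<^sup>2) + s * c * (b0 ^ 4 + 4 * a0\<^sup>2 - 1)"
    using osc_alpha_times_D[OF assms, of a0 t] by (simp add: \<alpha>_def D_def s_def c_def)
  have "N' * D - 2 * N * (2 * (\<alpha> * D)) = 2 * b0 ^ 3 * M * (s\<^sup>2 + c\<^sup>2)"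
    unfolding \<alpha>D unfolding D' N_def N'_def M_def P by algebra
  then have *: "N' * D - 2 * N * (2 * (\<alpha> * D)) = 2 * b0 ^ 3 * M" by (simp add: s_def c_def)
  have \<beta>\<epsilon>: "(osc_beta a0 b0 t) ^ 3 * osc_eps a0 b0 d0 e0 t = b0 ^ 3 * M / D\<^sup>2"
  proof -
    \<comment> \<open>The half-integer powers of D in beta^3 and epsilon combine to D^2.\<close>
    have "sqrt D ^ 3 * sqrt D = D\<^sup>2"
      using D by (simp add: power2_eq_square power3_eq_cube)
    then show ?thesis
      by (simp add: osc_beta_def osc_eps_def M_def D_def s_def P_def power_divide)
  qed
  have \<delta>: "osc_delta a0 b0 d0 e0 t = N / D"
    by (simp add: osc_delta_def N_def D_def P_def s_def)
  have "(osc_delta a0 b0 d0 e0 has_real_derivative (N' * D - N * (8 * \<alpha> * D)) / (D * D)) (at t)"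
    unfolding osc_delta_def[abs_def]
    by (rule derivative_eq_intros osc_D_deriv osc_P_deriv assms refl)+
       (use D in \<open>simp_all add: N_def N'_def P_def D_def \<alpha>_def s_def c_def\<close>)
  also have "(N' * D - N * (8 * \<alpha> * D)) / (D * D) = (2 * b0 ^ 3 * M) / D\<^sup>2 - 4 * \<alpha> * (N / D)"
    unfolding *[symmetric] using D by (simp add: divide_simps) algebra
  finally show ?thesis
    using \<beta>\<epsilon> by (simp add: \<delta> \<alpha>_def mult.assoc)
qed

lemma osc_eps_deriv:
  assumes "b0 \<noteq> 0"
  shows "(osc_eps a0 b0 d0 e0 has_real_derivative
           - 2 * osc_beta a0 b0 t * osc_delta a0 b0 d0 e0 t) (at t)"
proof -
  define s c where "s = sin (2 * t)" and "c = cos (2 * t)"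
  define \<alpha> D P where "\<alpha> = osc_alpha a0 b0 t" and "D = osc_D a0 b0 t" and "P = osc_P a0 t"
  define M M' N where "M = e0 * P - b0 * d0 * s"
    and "M' = e0 * (4 * a0 * c - 2 * s) - b0 * d0 * (2 * c)"
    and "N = d0 * P + e0 * b0 ^ 3 * s"
  have D: "D > 0" unfolding D_def by (rule osc_D_pos[OF assms])
  have P: "P = 2 * a0 * s + c" by (simp add: P_def osc_P_def s_def c_def)
  have D': "D = b0 ^ 4 * s\<^sup>2 + P\<^sup>2"
    by (simp add: D_def P_def osc_D_def s_def)
  have \<alpha>D: "2 * (\<alpha> * D) = 2 * a0 * (c\<^sup>2 - s\<^sup>2) + s * c * (b0 ^ 4 + 4 * a0\<^sup>2 - 1)"
    using osc_alpha_times_D[OF assms, of a0 t] by (simp add: \<alpha>_def D_def s_def c_def)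
  have "M' * D - 2 * M * (2 * (\<alpha> * D)) = - 2 * b0 * N * (s\<^sup>2 + c\<^sup>2)"
    unfolding \<alpha>D unfolding D' N_def M_def M'_def P by algebra
  then have "(M' - 4 * \<alpha> * M) * D = - 2 * b0 * N" by (simp add: s_def c_def algebra_simps)
  then have *: "M' - 4 * \<alpha> * M = - 2 * b0 * N / D" using D by (simp add: field_simps)
  have "(osc_eps a0 b0 d0 e0 has_real_derivative
          (M' * sqrt D - M * (4 * \<alpha> * sqrt D)) / (sqrt D * sqrt D)) (at t)"
    unfolding osc_eps_def[abs_def]
    by (rule derivative_eq_intros sqrt_osc_D_deriv osc_P_deriv assms refl)+
       (use D in \<open>simp_all add: M_def M'_def P_def D_def \<alpha>_def s_def c_def\<close>)
  also have "(M' * sqrt D - M * (4 * \<alpha> * sqrt D)) / (sqrt D * sqrt D) = (M' - 4 * \<alpha> * M) / sqrt D"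
    using D by (simp add: divide_simps) (simp add: algebra_simps)
  also have "\<dots> = - 2 * osc_beta a0 b0 t * osc_delta a0 b0 d0 e0 t"
    unfolding * by (simp add: osc_beta_def osc_delta_def N_def D_def P_def s_def)
  finally show ?thesis .
qed

text \<open>Write kappa - k0 = K / D. The numerator of the derivative over D^2 is b0^2 M^2 - N^2,
  where delta = N / D and epsilon = M / sqrt D.\<close>

lemma osc_kappa_deriv:
  assumes "b0 \<noteq> 0"
  shows "(osc_kappa a0 b0 d0 e0 k0 has_real_derivative
           - (osc_delta a0 b0 d0 e0 t)\<^sup>2 + (osc_beta a0 b0 t)\<^sup>2 * (osc_eps a0 b0 d0 e0 t)\<^sup>2) (at t)"
proof -
  define s c where "s = sin (2 * t)" and "c = cos (2 * t)"
  define \<alpha> D P where "\<alpha> = osc_alpha a0 b0 t" and "D = osc_D a0 b0 t" and "P = osc_P a0 t"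
  define M N where "M = e0 * P - b0 * d0 * s" and "N = d0 * P + e0 * b0 ^ 3 * s"
  define X Y where "X = e0 * b0\<^sup>2 * (a0 * e0 - b0 * d0) - a0 * d0\<^sup>2" and "Y = e0\<^sup>2 * b0\<^sup>2 - d0\<^sup>2"
  define K K' where "K = s\<^sup>2 * X + 1/2 * (s * c) * Y"
    and "K' = 4 * (s * c) * X + (c\<^sup>2 - s\<^sup>2) * Y"
  have D: "D > 0" unfolding D_def by (rule osc_D_pos[OF assms])
  have P: "P = 2 * a0 * s + c" by (simp add: P_def osc_P_def s_def c_def)
  have D': "D = b0 ^ 4 * s\<^sup>2 + P\<^sup>2"
    by (simp add: D_def P_def osc_D_def s_def)
  have \<alpha>D: "2 * (\<alpha> * D) = 2 * a0 * (c\<^sup>2 - s\<^sup>2) + s * c * (b0 ^ 4 + 4 * a0\<^sup>2 - 1)"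
    using osc_alpha_times_D[OF assms, of a0 t] by (simp add: \<alpha>_def D_def s_def c_def)
  have K2: "2 * K = 2 * s\<^sup>2 * X + s * c * Y" by (simp add: K_def)
  have "K' * D - 2 * (2 * K) * (2 * (\<alpha> * D)) = (b0\<^sup>2 * M\<^sup>2 - N\<^sup>2) * (s\<^sup>2 + c\<^sup>2)"
    unfolding \<alpha>D K2 unfolding D' N_def M_def K'_def X_def Y_def P by algebra
  then have *: "K' * D - 2 * (2 * K) * (2 * (\<alpha> * D)) = b0\<^sup>2 * M\<^sup>2 - N\<^sup>2" by (simp add: s_def c_def)
  have \<kappa>: "osc_kappa a0 b0 d0 e0 k0 =
      (\<lambda>t. k0 + ((sin (2 * t))\<^sup>2 * X + 1/2 * (sin (2 * t) * cos (2 * t)) * Y) / osc_D a0 b0 t)"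
    by (simp add: fun_eq_iff osc_kappa_def X_def Y_def sin_4 add_divide_distrib)
  have "(osc_kappa a0 b0 d0 e0 k0 has_real_derivative (K' * D - K * (8 * \<alpha> * D)) / (D * D)) (at t)"
    unfolding \<kappa>
    by (rule derivative_eq_intros osc_D_deriv assms refl)+
       (use D in \<open>simp_all add: K_def K'_def D_def \<alpha>_def s_def c_def algebra_simps power2_eq_square\<close>)
  also have "(K' * D - K * (8 * \<alpha> * D)) / (D * D) = (b0\<^sup>2 * M\<^sup>2 - N\<^sup>2) / D\<^sup>2"
    unfolding *[symmetric] by (simp add: power2_eq_square algebra_simps)
  also have "\<dots> = - (N / D)\<^sup>2 + b0\<^sup>2 / D * (M / sqrt D)\<^sup>2"
    using D by (simp add: power_divide power2_eq_square[of D] diff_divide_distrib)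
  finally show ?thesis
    by (simp add: osc_beta_power[OF assms] osc_delta_def osc_eps_def N_def M_def D_def P_def s_def)
qed

section \<open>The continuous branch of the arctangent in gamma\<close>

text \<open>An antiderivative \<open>g\<close> of \<open>- \<beta>\<^sup>2\<close> is a branch because, with \<open>\<theta> = 2 (g\<^sub>0 - g)\<close>, the quantity
  \<open>(P sin \<theta> - b\<^sub>0\<^sup>2 sin 2t cos \<theta>) / \<surd>D\<close> is constant in time, hence zero; that is,
  \<open>tan \<theta> = b\<^sub>0\<^sup>2 sin 2t / P\<close> wherever \<open>P \<noteq> 0\<close>.\<close>

lemma ex_is_gamma_branch:
  assumes "b0 \<noteq> 0"
  obtains g where "is_gamma_branch a0 b0 g0 g"
    and "\<And>t. (g has_real_derivative - (osc_beta a0 b0 t)\<^sup>2) (at t)"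
proof -
  have "isCont (\<lambda>t. - (osc_beta a0 b0 t)\<^sup>2) t" for t
    by (intro continuous_intros DERIV_isCont[OF osc_beta_deriv[OF assms]])
  then have "\<exists>G. \<forall>t::real. -\<infinity> < ereal t \<longrightarrow> ereal t < \<infinity> \<longrightarrow>
      (G has_vector_derivative - (osc_beta a0 b0 t)\<^sup>2) (at t)"
    by (intro einterval_antiderivative) auto
  then obtain G where G: "(G has_real_derivative - (osc_beta a0 b0 t)\<^sup>2) (at t)" for t
    by (auto simp: has_real_derivative_iff_has_vector_derivative)
  define g where "g t = g0 + (G t - G 0)" for t
  have g: "(g has_real_derivative - (osc_beta a0 b0 t)\<^sup>2) (at t)" for t
    unfolding g_def by (rule derivative_eq_intros G refl)+ simp
  define \<theta> where "\<theta> t = 2 * (g0 - g t)" for t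
  define v where "v t = (osc_P a0 t * sin (\<theta> t) - b0\<^sup>2 * sin (2 * t) * cos (\<theta> t)) / sqrt (osc_D a0 b0 t)" for t
  have "(v has_real_derivative 0) (at t)" for t
  proof -
    let ?D = "osc_D a0 b0 t" and ?P = "osc_P a0 t" and ?s = "sin (2 * t)" and ?c = "cos (2 * t)"
    let ?P' = "4 * a0 * ?c - 2 * ?s"
    let ?w = "?P * sin (\<theta> t) - b0\<^sup>2 * ?s * cos (\<theta> t)"
    let ?w' = "?P' * sin (\<theta> t) + 2 * b0\<^sup>2 / ?D * cos (\<theta> t) * ?P
       - (2 * b0\<^sup>2 * ?c * cos (\<theta> t) - b0\<^sup>2 * ?s * (2 * b0\<^sup>2 / ?D * sin (\<theta> t)))"
    have D: "?D > 0" by (rule osc_D_pos[OF assms])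
    have \<theta>: "(\<theta> has_real_derivative 2 * b0\<^sup>2 / ?D) (at t)"
      unfolding \<theta>_def osc_beta_power[OF assms, symmetric] times_divide_eq_right[symmetric]
      by (rule derivative_eq_intros g refl)+ simp
    have w: "((\<lambda>t. osc_P a0 t * sin (\<theta> t) - b0\<^sup>2 * sin (2 * t) * cos (\<theta> t)) has_real_derivative ?w') (at t)"
      by (rule derivative_eq_intros osc_P_deriv \<theta> refl)+ (simp add: mult_ac)
    define s c where "s = ?s" and "c = ?c"
    have "s\<^sup>2 + c\<^sup>2 = 1" by (simp add: s_def c_def)
    moreover have "osc_alpha a0 b0 t * ?D = a0 * (c\<^sup>2 - s\<^sup>2) + 1/2 * s * c * (b0 ^ 4 + 4 * a0\<^sup>2 - 1)"
      using osc_alpha_times_D[OF assms] by (simp add: s_def c_def)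
    \<comment> \<open>These identities say that the vector (P, b0^2 sin 2t), of length sqrt D, has
      derivative 4 alpha times itself plus a rotation at rate 2 b0^2 / D. That rate is the
      derivative of theta.\<close>
    ultimately have "(4 * a0 * c - 2 * s) * ?D + 2 * b0 ^ 4 * s = 4 * (osc_alpha a0 b0 t * ?D) * ?P
        \<and> ?P - c * ?D = - 2 * (osc_alpha a0 b0 t * ?D) * s"
      unfolding osc_D_def osc_P_def s_def[symmetric] c_def[symmetric] by (intro conjI) algebra+
    then have "?P' * ?D + 2 * b0 ^ 4 * ?s = 4 * (osc_alpha a0 b0 t * ?D) * ?P"
      and "?P - ?c * ?D = - 2 * (osc_alpha a0 b0 t * ?D) * ?s"
      unfolding s_def c_def by blast+
    moreover have "?w' * ?D = (?P' * ?D + 2 * b0 ^ 4 * ?s) * sin (\<theta> t) + 2 * b0\<^sup>2 * (?P - ?c * ?D) * cos (\<theta> t)"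
      using D by (simp add: field_simps)
    ultimately have "?w' * ?D = 4 * (osc_alpha a0 b0 t * ?D) * ?P * sin (\<theta> t)
        + 2 * b0\<^sup>2 * (- 2 * (osc_alpha a0 b0 t * ?D) * ?s) * cos (\<theta> t)"
      by (simp only:)
    then have "?w' * ?D = 4 * osc_alpha a0 b0 t * ?w * ?D"
      unfolding right_diff_distrib left_diff_distrib by (simp add: mult_ac)
    \<comment> \<open>The numerator of v satisfies the same linear equation as sqrt D, so their
      quotient v is constant.\<close>
    then have w': "?w' = 4 * osc_alpha a0 b0 t * ?w" using D by simp
    show ?thesis
      unfolding v_def
      by (rule derivative_eq_intros w sqrt_osc_D_deriv[OF assms] refl)+ (use D w' in simp_all)
  qed
  then have v0: "v t = v 0" for t using DERIV_isconst_all by blast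
  have v: "osc_P a0 t * sin (\<theta> t) = b0\<^sup>2 * sin (2 * t) * cos (\<theta> t)" for t
    using osc_D_pos[OF assms, of a0 t] v0[of t] by (simp add: v_def \<theta>_def g_def)
  have "\<exists>k::int. g t = g0 - 1/2 * (arctan (b0\<^sup>2 * sin (2 * t) / osc_P a0 t) + of_int k * pi)"
    if "osc_P a0 t \<noteq> 0" for t
  proof -
    \<comment> \<open>If cos theta = 0, then P sin theta = 0 forces sin theta = 0 as well, which is
      impossible.\<close>
    have c: "cos (\<theta> t) \<noteq> 0" using v[of t] that sin_zero_abs_cos_one[of "\<theta> t"] by auto
    then have "tan (\<theta> t) = b0\<^sup>2 * sin (2 * t) / osc_P a0 t"
      using v[of t] that by (simp add: tan_def field_simps)
    then obtain k :: int where
      k: "\<theta> t = arctan (b0\<^sup>2 * sin (2 * t) / osc_P a0 t) + k * pi \<or> \<theta> t = pi / 2 + k * pi"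
      unfolding tan_eq_arctan_Ex by blast
    \<comment> \<open>This alternative arises only because tan takes the default value 0 at its
      poles.\<close>
    moreover have "\<theta> t \<noteq> pi / 2 + k * pi"
      using c by (auto simp: cos_add sin_zero_iff_int2)
    ultimately show ?thesis by (intro exI[of _ k]) (auto simp: \<theta>_def field_simps)
  qed
  moreover have "continuous_on UNIV g" by (meson g DERIV_isCont continuous_at_imp_continuous_on)
  ultimately have "is_gamma_branch a0 b0 g0 g"
    by (auto simp: is_gamma_branch_def g_def)
  with g that show thesis by blast
qed

text \<open>The zeros of P are simple: P = P' = 0 would force cos 2t = 0 and then sin 2t = 0. At a
  simple zero the difference quotient, hence P, is nonzero nearby.\<close>

lemma eventually_osc_P_nonzero: "\<forall>\<^sub>F s in at t. osc_P a0 s \<noteq> 0"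
proof (cases "osc_P a0 t = 0")
  case True
  let ?P' = "4 * a0 * cos (2 * t) - 2 * sin (2 * t)"
  have "cos (2 * t) * (1 + 4 * a0\<^sup>2) = 0" if "?P' = 0"
    using that True unfolding osc_P_def by algebra
  moreover have "1 + 4 * a0\<^sup>2 > 0" by (simp add: add_pos_nonneg)
  ultimately have "?P' \<noteq> 0"
    using sin_zero_abs_cos_one[of "2 * t"] by auto
  moreover have "((\<lambda>s. (osc_P a0 s - osc_P a0 t) / (s - t)) \<longlongrightarrow> ?P') (at t)"
    using osc_P_deriv by (simp add: has_field_derivative_iff)
  ultimately have "\<forall>\<^sub>F s in at t. (osc_P a0 s - osc_P a0 t) / (s - t) \<noteq> 0"
    by (intro tendsto_imp_eventually_ne)
  then show ?thesis by eventually_elim (use True in auto)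
next
  case False
  then show ?thesis
    using osc_P_deriv[THEN DERIV_isCont] unfolding isCont_def by (rule tendsto_imp_eventually_ne[rotated])
qed

text \<open>Two branches differ by an element of \<open>(\<pi>/2) \<int>\<close> off the isolated zeros of \<open>osc_P a0\<close>, hence
  everywhere by continuity, and so by a constant.\<close>

lemma is_gamma_branch_unique:
  assumes g: "is_gamma_branch a0 b0 g0 g" and h: "is_gamma_branch a0 b0 g0 h"
  shows "g = h"
proof
  fix t
  define d where "d t = g t - h t" for t
  have cont: "continuous_on UNIV d"
    using g h unfolding d_def is_gamma_branch_def by (intro continuous_intros) auto
  \<comment> \<open>Membership of d in (pi/2) Z is encoded as sin (2 d) = 0, a condition preserved
    under limits.\<close>
  have P: "sin (2 * d s) = 0" if "osc_P a0 s \<noteq> 0" for s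
  proof -
    from g h that obtain k l :: int where
      "g s = g0 - 1/2 * (arctan (b0\<^sup>2 * sin (2 * s) / osc_P a0 s) + of_int k * pi)"
      "h s = g0 - 1/2 * (arctan (b0\<^sup>2 * sin (2 * s) / osc_P a0 s) + of_int l * pi)"
      unfolding is_gamma_branch_def by meson
    then have "2 * d s = of_int (l - k) * pi" by (simp add: d_def field_simps)
    then show ?thesis unfolding sin_zero_iff_int2 by blast
  qed
  have sin0: "sin (2 * d s) = 0" for s
  proof (rule tendsto_unique)
    have "isCont d s" using cont by (simp add: continuous_on_eq_continuous_at)
    then show "((\<lambda>s. sin (2 * d s)) \<longlongrightarrow> sin (2 * d s)) (at s)"
      unfolding isCont_def by (intro tendsto_intros)
    show "((\<lambda>s. sin (2 * d s)) \<longlongrightarrow> 0) (at s)"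
      using eventually_osc_P_nonzero[of a0 s] by (intro tendsto_eventually) (auto elim: eventually_mono dest: P)
  qed auto
  have "d constant_on UNIV"
  proof (rule continuous_discrete_range_constant)
    fix x
    \<comment> \<open>Distinct multiples of pi/2 are at least pi/2 apart, so d has a uniformly
      discrete range on a connected set.\<close>
    have "pi / 2 \<le> norm (d y - d x)" if "d y \<noteq> d x" for y
    proof -
      obtain i j :: int where ij: "2 * d x = of_int i * pi" "2 * d y = of_int j * pi"
        using sin0[of x] sin0[of y] unfolding sin_zero_iff_int2 by blast
      then have "d y - d x = of_int (j - i) * (pi / 2)" by (simp add: field_simps)
      moreover have "\<bar>of_int (j - i) :: real\<bar> \<ge> 1" using that ij
        by (cases "i = j") (auto simp: of_int_abs[symmetric] simp del: of_int_abs of_int_diff)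
      ultimately show ?thesis using mult_right_mono[of 1 "\<bar>of_int (j - i)\<bar>" "pi / 2"]
        by (simp only: abs_mult real_norm_def) simp
    qed
    then show "\<exists>e>0. \<forall>y. y \<in> UNIV \<and> d y \<noteq> d x \<longrightarrow> e \<le> norm (d y - d x)"
      by (intro exI[of _ "pi / 2"]) auto
  qed (use cont in auto)
  moreover have "d 0 = 0" using g h by (simp add: d_def is_gamma_branch_def)
  ultimately show "g t = h t" unfolding constant_on_def d_def by (metis UNIV_I eq_iff_diff_eq_0)
qed

lemma ex1_is_gamma_branch:
  assumes "b0 \<noteq> 0"
  shows "\<exists>!g. is_gamma_branch a0 b0 g0 g"
  using ex_is_gamma_branch[OF assms] is_gamma_branch_unique by metis

lemma osc_gamma_branch:
  assumes "b0 \<noteq> 0"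
  shows "is_gamma_branch a0 b0 g0 (osc_gamma a0 b0 g0)"
  unfolding osc_gamma_def by (rule theI'[OF ex1_is_gamma_branch[OF assms]])

text \<open>By uniqueness the branch is the antiderivative constructed for existence, so its
  derivative is known even at zeros of P.\<close>

lemma osc_gamma_deriv:
  assumes "b0 \<noteq> 0"
  shows "(osc_gamma a0 b0 g0 has_real_derivative - (osc_beta a0 b0 t)\<^sup>2) (at t)"
  using ex_is_gamma_branch[OF assms] is_gamma_branch_unique osc_gamma_branch[OF assms] by metis

section \<open>Madelung form of the Schroedinger equation\<close>

lemma has_vector_derivative_phase_mult:
  fixes S :: "real \<Rightarrow> real" and F :: "real \<Rightarrow> complex"
  assumes S: "(S has_real_derivative S') (at u)" and F: "(F has_vector_derivative F') (at u)"
  shows "((\<lambda>s. c * exp (\<i> * of_real (S s)) * F s) has_vector_derivative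
           c * exp (\<i> * of_real (S u)) * (F' + \<i> * of_real S' * F u)) (at u)"
proof -
  have "((\<lambda>z. c * exp (\<i> * z)) has_field_derivative c * (exp (\<i> * of_real (S u)) * \<i>)) (at (of_real (S u)))"
    by (auto intro!: derivative_eq_intros)
  with has_vector_derivative_of_real[OF S]
  have "((\<lambda>z. c * exp (\<i> * z)) \<circ> (\<lambda>s. of_real (S s)) has_vector_derivative
          of_real S' * (c * (exp (\<i> * of_real (S u)) * \<i>))) (at u)"
    by (rule field_vector_diff_chain_at)
  then have "((\<lambda>s. c * exp (\<i> * of_real (S s))) has_vector_derivative
          of_real S' * (c * (exp (\<i> * of_real (S u)) * \<i>))) (at u)"
    by (simp add: o_def)
  from has_vector_derivative_mult[OF this F] show ?thesis
    by (simp add: algebra_simps)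
qed

text \<open>The Madelung form: for \<open>\<psi> = c e\<^sup>i\<^sup>S R\<close> the imaginary and real parts of the equation are a continuity
  equation and a quantum Hamilton-Jacobi equation.\<close>

lemma solves_oscillator_schroedinger_madelung:
  fixes S R St Sx Sxx Rt Rx Rxx :: "real \<Rightarrow> real \<Rightarrow> real"
  assumes St: "\<And>x t. ((\<lambda>s. S x s) has_real_derivative St x t) (at t)"
    and Sx: "\<And>x t. ((\<lambda>y. S y t) has_real_derivative Sx x t) (at x)"
    and Sxx: "\<And>x t. ((\<lambda>y. Sx y t) has_real_derivative Sxx x t) (at x)"
    and Rt: "\<And>x t. ((\<lambda>s. R x s) has_real_derivative Rt x t) (at t)"
    and Rx: "\<And>x t. ((\<lambda>y. R y t) has_real_derivative Rx x t) (at x)"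
    and Rxx: "\<And>x t. ((\<lambda>y. Rx y t) has_real_derivative Rxx x t) (at x)"
    and continuity: "\<And>x t. Rt x t = - 2 * Sx x t * Rx x t - Sxx x t * R x t"
    and hamilton_jacobi: "\<And>x t. - St x t * R x t = - Rxx x t + ((Sx x t)\<^sup>2 + x\<^sup>2) * R x t"
  shows "solves_oscillator_schroedinger (\<lambda>x t. c * exp (\<i> * of_real (S x t)) * of_real (R x t))"
  unfolding solves_oscillator_schroedinger_def
proof (intro exI allI conjI)
  fix x t
  let ?E = "c * exp (\<i> * of_real (S x t))"
  show "((\<lambda>s. c * exp (\<i> * of_real (S x s)) * of_real (R x s)) has_vector_derivative
      c * exp (\<i> * of_real (S x t)) * (of_real (Rt x t) + \<i> * of_real (St x t) * of_real (R x t))) (at t)"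
    by (intro has_vector_derivative_phase_mult has_vector_derivative_of_real St Rt)
  show "((\<lambda>y. c * exp (\<i> * of_real (S y t)) * of_real (R y t)) has_vector_derivative
      c * exp (\<i> * of_real (S x t)) * (of_real (Rx x t) + \<i> * of_real (Sx x t) * of_real (R x t))) (at x)"
    by (intro has_vector_derivative_phase_mult has_vector_derivative_of_real Sx Rx)
  have "((\<lambda>y. of_real (Rx y t) + \<i> * of_real (Sx y t) * of_real (R y t) :: complex) has_vector_derivative
      of_real (Rxx x t) + (\<i> * of_real (Sx x t) * of_real (Rx x t) + \<i> * of_real (Sxx x t) * of_real (R x t))) (at x)"
    by (intro has_vector_derivative_add has_vector_derivative_mult has_vector_derivative_mult_right
        has_vector_derivative_of_real Sx Rx Sxx Rxx)
  \<comment> \<open>The first x-derivative is again the phase times a complex function, R_x + i S_x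
    R, so the same product rule applies a second time.\<close>
  from has_vector_derivative_phase_mult[OF Sx this]
  show "((\<lambda>y. c * exp (\<i> * of_real (S y t)) * (of_real (Rx y t) + \<i> * of_real (Sx y t) * of_real (R y t)))
     has_vector_derivative
       c * exp (\<i> * of_real (S x t)) *
      (of_real (Rxx x t) + (\<i> * of_real (Sx x t) * of_real (Rx x t) + \<i> * of_real (Sxx x t) * of_real (R x t))
        + \<i> * of_real (Sx x t) * (of_real (Rx x t) + \<i> * of_real (Sx x t) * of_real (R x t)))) (at x)" .
  have "\<i> * (of_real (Rt x t) + \<i> * of_real (St x t) * of_real (R x t))
      = - (of_real (Rxx x t) + (\<i> * of_real (Sx x t) * of_real (Rx x t) + \<i> * of_real (Sxx x t) * of_real (R x t))
        + \<i> * of_real (Sx x t) * (of_real (Rx x t) + \<i> * of_real (Sx x t) * of_real (R x t)))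
       + of_real (x\<^sup>2) * of_real (R x t)"
    using continuity[of x t] hamilton_jacobi[of x t]
    by (simp add: complex_eq_iff algebra_simps power2_eq_square)
  then show "\<i> * (?E * (of_real (Rt x t) + \<i> * of_real (St x t) * of_real (R x t)))
      = - (?E * (of_real (Rxx x t) + (\<i> * of_real (Sx x t) * of_real (Rx x t) + \<i> * of_real (Sxx x t) * of_real (R x t))
        + \<i> * of_real (Sx x t) * (of_real (Rx x t) + \<i> * of_real (Sx x t) * of_real (R x t))))
       + of_real (x\<^sup>2) * (?E * of_real (R x t))"
    by algebra
qed

section \<open>Hermite functions\<close>

definition hermite_fun :: "nat \<Rightarrow> real \<Rightarrow> real" where
  "hermite_fun n y = exp (- y\<^sup>2 / 2) * hermite n y"

text \<open>The factor e^{-y^2/2} turns Hermite's equation into the eigenvalue equation of -d^2/dy^2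
  + y^2 with eigenvalue 2n+1.\<close>

lemma hermite_fun_derivs:
  obtains F' where "\<And>y. (hermite_fun n has_real_derivative F' y) (at y)"
    and "\<And>y. (F' has_real_derivative (y\<^sup>2 - (2 * real n + 1)) * hermite_fun n y) (at y)"
proof
  let ?p = "hermite_poly n"
  let ?F' = "\<lambda>y. exp (- y\<^sup>2 / 2) * (poly (pderiv ?p) y - y * poly ?p y)"
  fix y
  show "(hermite_fun n has_real_derivative ?F' y) (at y)"
    unfolding hermite_fun_def[abs_def] hermite_eq_poly
    by (auto intro!: derivative_eq_intros simp: algebra_simps)
  have "poly (pderiv (pderiv ?p) - [:0, 2:] * pderiv ?p + of_nat (2 * n) * ?p) y = 0"
    unfolding hermite_poly_ode by simp
  then have ode: "poly (pderiv (pderiv ?p)) y = 2 * y * poly (pderiv ?p) y - 2 * real n * poly ?p y"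
    by (simp add: algebra_simps)
  show "(?F' has_real_derivative (y\<^sup>2 - (2 * real n + 1)) * hermite_fun n y) (at y)"
    unfolding hermite_fun_def hermite_eq_poly
    by (auto intro!: derivative_eq_intros simp: ode algebra_simps power2_eq_square)
qed

lemma integrable_hermite_fun_square: "integrable lborel (\<lambda>y. (hermite_fun n y)\<^sup>2)"
proof -
  have "(hermite_fun n y)\<^sup>2 = exp (- y\<^sup>2) * poly (hermite_poly n ^ 2) y" for y
    by (simp add: hermite_fun_def hermite_eq_poly power_mult_distrib flip: exp_double)
  then show ?thesis by (simp only: integrable_poly_gaussian)
qed

section \<open>The oscillator states: Schroedinger equation and square integrability\<close>

lemma osc_psi_eq:
  assumes "b0 \<noteq> 0"
  shows "osc_psi m0 a0 b0 g0 d0 e0 k0 n x t =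
    1 / csqrt (of_real (2 ^ n * fact n * m0 * sqrt pi))
    * exp (\<i> * of_real (osc_alpha a0 b0 t * x\<^sup>2 + osc_delta a0 b0 d0 e0 t * x + osc_kappa a0 b0 d0 e0 k0 t
              + (2 * real n + 1) * osc_gamma a0 b0 g0 t))
    * of_real (1 / sqrt (sqrt (osc_D a0 b0 t))
        * hermite_fun n (osc_beta a0 b0 t * x + osc_eps a0 b0 d0 e0 t))"
proof -
  have "2 ^ n * fact n * osc_mu m0 a0 b0 t * sqrt pi
      = sqrt (osc_D a0 b0 t) * (2 ^ n * fact n * m0 * sqrt pi)"
    by (simp add: osc_mu_def)
  \<comment> \<open>The root of mu splits into D^{1/4}, which joins the real amplitude, and a
    constant carrying the sign of m0.\<close>
  then have *: "csqrt (of_real (2 ^ n * fact n * osc_mu m0 a0 b0 t * sqrt pi))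
      = of_real (sqrt (sqrt (osc_D a0 b0 t))) * csqrt (of_real (2 ^ n * fact n * m0 * sqrt pi))"
    using osc_D_pos[OF assms, of a0 t] by (simp only: csqrt_of_real_mult_nonneg real_sqrt_ge_zero less_imp_le)
  show ?thesis
    unfolding osc_psi_def Let_def *
    by (simp add: hermite_fun_def ring_distribs mult_ac)
qed

lemma osc_psi_solves:
  assumes b0: "b0 \<noteq> 0"
  shows "solves_oscillator_schroedinger (osc_psi m0 a0 b0 g0 d0 e0 k0 n)"
proof -
  define \<alpha> \<beta> \<gamma> \<delta> \<epsilon> \<kappa> where "\<alpha> = osc_alpha a0 b0" and "\<beta> = osc_beta a0 b0" and "\<gamma> = osc_gamma a0 b0 g0"
    and "\<delta> = osc_delta a0 b0 d0 e0" and "\<epsilon> = osc_eps a0 b0 d0 e0" and "\<kappa> = osc_kappa a0 b0 d0 e0 k0"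
  note derivs = osc_alpha_deriv[OF b0, of a0, folded \<alpha>_def \<beta>_def]
    osc_beta_deriv[OF b0, of a0, folded \<alpha>_def \<beta>_def]
    osc_gamma_deriv[OF b0, of a0 g0, folded \<gamma>_def \<beta>_def]
    osc_delta_deriv[OF b0, of a0 d0 e0, folded \<alpha>_def \<beta>_def \<delta>_def \<epsilon>_def]
    osc_eps_deriv[OF b0, of a0 d0 e0, folded \<beta>_def \<delta>_def \<epsilon>_def]
    osc_kappa_deriv[OF b0, of a0 d0 e0 k0, folded \<beta>_def \<delta>_def \<epsilon>_def \<kappa>_def]
  define A where "A t = 1 / sqrt (sqrt (osc_D a0 b0 t))" for t
  \<comment> \<open>As S_xx = 2 alpha, this is A' = - S_xx A, the last term of the continuity
    equation.\<close>
  have A: "(A has_real_derivative - 2 * \<alpha> t * A t) (at t)" for t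
  proof -
    have D: "sqrt (osc_D a0 b0 t) > 0" using osc_D_pos[OF b0, of a0 t] by simp
    have "((\<lambda>t. sqrt (sqrt (osc_D a0 b0 t))) has_real_derivative
        2 * \<alpha> t * sqrt (sqrt (osc_D a0 b0 t))) (at t)"
      by (rule DERIV_chain2[OF DERIV_real_sqrt sqrt_osc_D_deriv, THEN DERIV_cong])
        (use D b0 in \<open>simp_all add: \<alpha>_def field_simps flip: power2_eq_square\<close>)
    from DERIV_inverse'[OF this] D show ?thesis
      unfolding A_def[abs_def] by (simp add: field_simps)
  qed
  obtain F' where F: "\<And>y. (hermite_fun n has_real_derivative F' y) (at y)"
    and F': "\<And>y. (F' has_real_derivative (y\<^sup>2 - (2 * real n + 1)) * hermite_fun n y) (at y)"
    using hermite_fun_derivs[of n] by metis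
  note F = DERIV_chain2[OF F] and F' = DERIV_chain2[OF F']
  define y where "y x t = \<beta> t * x + \<epsilon> t" for x t
  \<comment> \<open>The argument y is transported with velocity 2 S_x: the right side equals -2 S_x
    y_x with S_x = 2 alpha x + delta.\<close>
  have yt: "((\<lambda>s. y x s) has_real_derivative - 4 * \<alpha> t * \<beta> t * x - 2 * \<beta> t * \<delta> t) (at t)" for x t
    unfolding y_def by (rule derivative_eq_intros derivs refl)+ simp
  have yx: "((\<lambda>x. y x t) has_real_derivative \<beta> t) (at x)" for x t
    unfolding y_def by (rule derivative_eq_intros refl)+ simp
  let ?H = "\<lambda>x t. hermite_fun n (y x t)"
  have "solves_oscillator_schroedinger (\<lambda>x t. 1 / csqrt (of_real (2 ^ n * fact n * m0 * sqrt pi))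
    * exp (\<i> * of_real (\<alpha> t * x\<^sup>2 + \<delta> t * x + \<kappa> t + (2 * real n + 1) * \<gamma> t)) * of_real (A t * ?H x t))"
  proof (rule solves_oscillator_schroedinger_madelung)
    fix x t
    show "((\<lambda>t. \<alpha> t * x\<^sup>2 + \<delta> t * x + \<kappa> t + (2 * real n + 1) * \<gamma> t) has_real_derivative
      (\<beta> t ^ 4 - 1 - 4 * (\<alpha> t)\<^sup>2) * x\<^sup>2 + (2 * \<beta> t ^ 3 * \<epsilon> t - 4 * \<alpha> t * \<delta> t) * x
        + (- (\<delta> t)\<^sup>2 + (\<beta> t)\<^sup>2 * (\<epsilon> t)\<^sup>2) - (2 * real n + 1) * (\<beta> t)\<^sup>2) (at t)"
      by (rule derivative_eq_intros derivs refl)+ simp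
    show "((\<lambda>x. \<alpha> t * x\<^sup>2 + \<delta> t * x + \<kappa> t + (2 * real n + 1) * \<gamma> t) has_real_derivative
      2 * \<alpha> t * x + \<delta> t) (at x)"
      by (rule derivative_eq_intros refl)+ simp
    show "((\<lambda>x. 2 * \<alpha> t * x + \<delta> t) has_real_derivative 2 * \<alpha> t) (at x)"
      by (rule derivative_eq_intros refl)+ simp
    show "((\<lambda>t. A t * ?H x t) has_real_derivative
        - 2 * \<alpha> t * A t * ?H x t + A t * (F' (y x t) * (- 4 * \<alpha> t * \<beta> t * x - 2 * \<beta> t * \<delta> t))) (at t)"
      by (rule derivative_eq_intros A F yt refl)+ simp
    show "((\<lambda>x. A t * ?H x t) has_real_derivative A t * (F' (y x t) * \<beta> t)) (at x)"
      by (rule derivative_eq_intros F yx refl)+ simp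
    show "((\<lambda>x. A t * (F' (y x t) * \<beta> t)) has_real_derivative
        A t * ((((y x t)\<^sup>2 - (2 * real n + 1)) * ?H x t * \<beta> t) * \<beta> t)) (at x)"
      by (rule derivative_eq_intros F' yx refl)+ simp
    show "- 2 * \<alpha> t * A t * ?H x t + A t * (F' (y x t) * (- 4 * \<alpha> t * \<beta> t * x - 2 * \<beta> t * \<delta> t))
        = - 2 * (2 * \<alpha> t * x + \<delta> t) * (A t * (F' (y x t) * \<beta> t)) - 2 * \<alpha> t * (A t * ?H x t)"
      by (simp add: algebra_simps)
    \<comment> \<open>The (2n+1) beta^2 from gamma' cancels the eigenvalue term, and the Ermakov
      equations match the powers of x. A free h in place of the Hermite function makes this a
      polynomial identity.\<close>
    have "- ((\<beta> t ^ 4 - 1 - 4 * (\<alpha> t)\<^sup>2) * x\<^sup>2 + (2 * \<beta> t ^ 3 * \<epsilon> t - 4 * \<alpha> t * \<delta> t) * x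
        + (- (\<delta> t)\<^sup>2 + (\<beta> t)\<^sup>2 * (\<epsilon> t)\<^sup>2) - (2 * real n + 1) * (\<beta> t)\<^sup>2) * (A t * h)
      = - (A t * ((((\<beta> t * x + \<epsilon> t)\<^sup>2 - (2 * real n + 1)) * h * \<beta> t) * \<beta> t))
        + ((2 * \<alpha> t * x + \<delta> t)\<^sup>2 + x\<^sup>2) * (A t * h)" for h
      by algebra
    then show "- ((\<beta> t ^ 4 - 1 - 4 * (\<alpha> t)\<^sup>2) * x\<^sup>2 + (2 * \<beta> t ^ 3 * \<epsilon> t - 4 * \<alpha> t * \<delta> t) * x
        + (- (\<delta> t)\<^sup>2 + (\<beta> t)\<^sup>2 * (\<epsilon> t)\<^sup>2) - (2 * real n + 1) * (\<beta> t)\<^sup>2) * (A t * ?H x t)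
      = - (A t * ((((y x t)\<^sup>2 - (2 * real n + 1)) * ?H x t * \<beta> t) * \<beta> t))
        + ((2 * \<alpha> t * x + \<delta> t)\<^sup>2 + x\<^sup>2) * (A t * ?H x t)"
      unfolding y_def .
  qed
  also have "(\<lambda>x t. 1 / csqrt (of_real (2 ^ n * fact n * m0 * sqrt pi))
    * exp (\<i> * of_real (\<alpha> t * x\<^sup>2 + \<delta> t * x + \<kappa> t + (2 * real n + 1) * \<gamma> t)) * of_real (A t * ?H x t))
    = osc_psi m0 a0 b0 g0 d0 e0 k0 n"
    unfolding osc_psi_eq[OF b0, abs_def] A_def y_def \<alpha>_def \<beta>_def \<gamma>_def \<delta>_def \<epsilon>_def \<kappa>_def ..
  finally show ?thesis .
qed

text \<open>The phase has modulus 1, so |psi|^2 is a constant times a squared Hermite function of an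
  affine argument whose slope beta is nonzero. Measurability follows from continuity in x.\<close>

lemma osc_psi_square_integrable:
  assumes b0: "b0 \<noteq> 0"
  shows "square_integrable (\<lambda>x. osc_psi m0 a0 b0 g0 d0 e0 k0 n x t)"
proof -
  let ?\<psi> = "\<lambda>x. osc_psi m0 a0 b0 g0 d0 e0 k0 n x t"
  have \<beta>: "osc_beta a0 b0 t \<noteq> 0" using osc_D_pos[OF b0, of a0 t] b0 by (simp add: osc_beta_def)
  obtain \<psi>x where "\<And>x. (?\<psi> has_vector_derivative \<psi>x x t) (at x)"
    using osc_psi_solves[OF b0] unfolding solves_oscillator_schroedinger_def by metis
  then have "continuous_on UNIV ?\<psi>"
    by (meson has_vector_derivative_continuous continuous_at_imp_continuous_on)
  then have "?\<psi> \<in> borel_measurable lborel"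
    by (simp add: borel_measurable_continuous_onI)
  moreover have "(norm (?\<psi> x))\<^sup>2 = (norm (1 / csqrt (of_real (2 ^ n * fact n * m0 * sqrt pi))))\<^sup>2
      * (1 / sqrt (sqrt (osc_D a0 b0 t)))\<^sup>2
      * (hermite_fun n (osc_eps a0 b0 d0 e0 t + osc_beta a0 b0 t * x))\<^sup>2" for x
    unfolding osc_psi_eq[OF b0] norm_mult norm_exp_i_times norm_of_real
    by (simp only: power_mult_distrib abs_mult power2_abs add.commute) simp
  then have "integrable lborel (\<lambda>x. (norm (?\<psi> x))\<^sup>2)"
    by (simp only:) (intro integrable_mult_right
        lborel_integrable_real_affine[OF integrable_hermite_fun_square \<beta>])
  ultimately show ?thesis unfolding square_integrable_def by blast
qed

section \<open>The textbook case\<close>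

lemma osc_gamma_ground: "osc_gamma 0 1 0 t = - t"
proof -
  \<comment> \<open>For these data D = beta = 1, so gamma' = -1; this avoids following the branches
    of arctan (tan 2t).\<close>
  have "((\<lambda>t. osc_gamma 0 1 0 t + t) has_real_derivative 0) (at t)" for t
    by (rule derivative_eq_intros osc_gamma_deriv refl)+
       (simp_all add: osc_beta_power osc_D_def osc_P_def)
  then have "osc_gamma 0 1 0 t + t = osc_gamma 0 1 0 0 + 0"
    by (intro DERIV_isconst_all) auto
  then show ?thesis using osc_gamma_branch[of 1 0 0] by (simp add: is_gamma_branch_def)
qed

text \<open>As mu(0) stays free, the constant 1 / \<open>csqrt\<close> m0 remains; it is 1 for m0 =
  1. The energy phase comes from gamma = -t.\<close>

lemma osc_psi_textbook:
  "osc_psi m0 0 1 0 0 0 0 n x t = textbook_state n x t / csqrt (of_real m0)"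
proof -
  have D: "osc_D 0 1 t = 1" by (simp add: osc_D_def osc_P_def)
  have c: "csqrt (of_real (2 ^ n * fact n * m0 * sqrt pi))
      = of_real (sqrt (2 ^ n * fact n * sqrt pi)) * csqrt (of_real m0)"
    using csqrt_of_real_mult_nonneg[of "2 ^ n * fact n * sqrt pi" m0] by (simp add: mult_ac)
  have "osc_alpha 0 1 t = 0" "osc_beta 0 1 t = 1" "osc_delta 0 1 0 0 t = 0"
    "osc_eps 0 1 0 0 t = 0" "osc_kappa 0 1 0 0 0 t = 0"
    by (simp_all add: D osc_alpha_def osc_beta_def osc_delta_def osc_eps_def osc_kappa_def)
  then show ?thesis
    unfolding osc_psi_eq[OF one_neq_zero] c textbook_state_def hermite_fun_def osc_gamma_ground D
    by simp
qed

theorem mainTheorem2: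
  fixes m0 a0 b0 g0 d0 e0 k0 :: real
  assumes "m0 \<noteq> 0" and "b0 \<noteq> 0"
  shows "(\<exists>!g. is_gamma_branch a0 b0 g0 g) \<and>
    ermakov_system (osc_mu m0 a0 b0) (osc_alpha a0 b0) (osc_beta a0 b0) (osc_gamma a0 b0 g0)
      (osc_delta a0 b0 d0 e0) (osc_eps a0 b0 d0 e0) (osc_kappa a0 b0 d0 e0 k0) \<and>
    osc_mu m0 a0 b0 0 = m0 \<and> osc_alpha a0 b0 0 = a0 \<and> osc_beta a0 b0 0 = b0 \<and>
    osc_gamma a0 b0 g0 0 = g0 \<and> osc_delta a0 b0 d0 e0 0 = d0 \<and>
    osc_eps a0 b0 d0 e0 0 = e0 \<and> osc_kappa a0 b0 d0 e0 k0 0 = k0 \<and>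
    (\<forall>n. solves_oscillator_schroedinger (osc_psi m0 a0 b0 g0 d0 e0 k0 n) \<and>
         (\<forall>t. square_integrable (\<lambda>x. osc_psi m0 a0 b0 g0 d0 e0 k0 n x t))) \<and>
    (b0 = 1 \<and> a0 = 0 \<and> g0 = 0 \<and> d0 = 0 \<and> e0 = 0 \<and> k0 = 0 \<longrightarrow>
       (\<forall>n x t. osc_psi m0 a0 b0 g0 d0 e0 k0 n x t
                  = textbook_state n x t / csqrt (of_real m0)))"
proof -
  have \<mu>: "osc_mu m0 a0 b0 t \<noteq> 0" for t
    using assms osc_D_pos[OF assms(2), of a0 t] by (simp add: osc_mu_def)
  have "ermakov_system (osc_mu m0 a0 b0) (osc_alpha a0 b0) (osc_beta a0 b0) (osc_gamma a0 b0 g0)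
      (osc_delta a0 b0 d0 e0) (osc_eps a0 b0 d0 e0) (osc_kappa a0 b0 d0 e0 k0)"
    unfolding ermakov_system_def
    \<comment> \<open>Each derivative lemma has the right side prescribed by the system, so with
      these derivatives the equations become trivial.\<close>
    by (rule exI allI conjI osc_mu_deriv osc_alpha_deriv osc_beta_deriv osc_gamma_deriv
        osc_delta_deriv osc_eps_deriv osc_kappa_deriv assms \<mu>)+ (simp_all add: \<mu>)
  moreover have "osc_gamma a0 b0 g0 0 = g0"
    using osc_gamma_branch[OF assms(2)] by (simp add: is_gamma_branch_def)
  moreover have "osc_D a0 b0 0 = 1" "osc_P a0 0 = 1"
    by (simp_all add: osc_D_def osc_P_def)
  ultimately show ?thesis
    using ex1_is_gamma_branch osc_psi_solves osc_psi_square_integrable osc_psi_textbook assms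
    by (simp add: osc_mu_def osc_alpha_def osc_beta_def osc_delta_def osc_eps_def osc_kappa_def)
qed

end
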